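(* Let $n \geq 4$ be an integer and let $G$ be a (finite, simple) labelled graph with vertex set $V(G) = \{w_1, w_2, \ldots, w_n\}$. Suppose that $d(u) + d(v) \geq \frac{3n-1}{2}$ for each pair $u, v$ of non-adjacent vertices of $G$, where $d(\cdot)$ denotes degree in $G$. Then for every arboreal sequence $\sigma = d_1, d_2, \ldots, d_n$ with $1 \leq d_i \leq 3$ for $i = 1, 2, \ldots, n$, the graph $G$ contains a spanning tree $T$ with degree sequence $\sigma$.
   Context: An arboreal sequence is a sequence of positive integers $d_1, d_2, \ldots, d_n$ such that $\sum_{j=1}^{n} d_j = 2(n-1)$. For a labelled graph $G$ with vertex set $\{w_1,\ldots,w_n\}$ and an arboreal sequence $\sigma = d_1,\ldots,d_n$, a spanning tree $T$ of $G$ has degree sequence $\sigma$ if $d_T(w_i) = d_i$ for $i = 1, 2, \ldots, n$, where $d_T(w_i)$ is the degree of $w_i$ in $T$. *)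

theory Defs
  imports "Graph_Theory.Graph_Theory"
begin

text \<open>
  A finite simple graph is a \<^const>\<open>pair_graph\<close>: a finite, loop-free, symmetric set of
  pairs, each undirected edge being present in both orientations.  The degree of a vertex is
  therefore the number of arcs leaving it.
\<close>

definition vdegree :: "'a pair_pre_digraph \<Rightarrow> 'a \<Rightarrow> nat" where
  "vdegree G v = out_degree (with_proj G) v"

text \<open>
  \<^const>\<open>Digraph_Component.tree\<close> forbids all directed cycles, and in a symmetric digraph the
  two orientations of a single edge already form a directed cycle of length 2.  The cycles of the
  underlying undirected graph are exactly the directed cycles of length at least 3.
\<close>

definition graph_tree :: "'a pair_pre_digraph \<Rightarrow> bool" where
  "graph_tree T \<longleftrightarrow>
     pair_graph T \<and> Digraph_Component.connected (with_proj T) \<and>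
     \<not> (\<exists>p. pre_digraph.cycle (with_proj T) p \<and> length p \<ge> 3)"

definition graph_spanning_tree :: "'a pair_pre_digraph \<Rightarrow> 'a pair_pre_digraph \<Rightarrow> bool" where
  "graph_spanning_tree T G \<longleftrightarrow> graph_tree T \<and> spanning (with_proj T) (with_proj G)"

definition arboreal :: "nat \<Rightarrow> (nat \<Rightarrow> nat) \<Rightarrow> bool" where
  "arboreal n d \<longleftrightarrow>
     (\<forall>i\<in>{1..n}. d i > 0) \<and> (\<Sum>j=1..n. int (d j)) = 2 * (int n - 1)"

definition has_degree_sequence ::
  "'a pair_pre_digraph \<Rightarrow> nat \<Rightarrow> (nat \<Rightarrow> 'a) \<Rightarrow> (nat \<Rightarrow> nat) \<Rightarrow> bool" where
  "has_degree_sequence T n w d \<longleftrightarrow> (\<forall>i\<in>{1..n}. vdegree T (w i) = d i)"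

end

theory Submission
  imports Defs
begin

text \<open>
  Among all trees on the vertex set with the prescribed degrees, take one with the fewest edges in
  the complement \<open>H\<close> of the graph, and suppose it still contains an edge \<open>uv\<close> of \<open>H\<close>.  Let \<open>xy\<close> be
  another tree edge with \<open>x\<close> closer to \<open>uv\<close>, lying on the side of \<open>v\<close> say, and \<open>x \<noteq> v\<close>.  Replacing \<open>uv\<close> and
  \<open>xy\<close> by \<open>ux\<close> and \<open>vy\<close> gives another tree with the same degrees.  As all degrees are at most 3,
  there are at least \<open>n - 6\<close> choices for \<open>xy\<close>, and every non-edge at \<open>u\<close> or \<open>v\<close> other than \<open>uv\<close>
  rules out at most two of them.  The degree condition bounds the number of those excluded by
  \<open>n - 7\<close>, so some exchange strictly reduces the number of edges in \<open>H\<close>.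
\<close>

section \<open>Trees as relations, parent functions and arc counts\<close>

text \<open>
  Trees are encoded as connected symmetric relations: once the degrees sum to \<open>2 (n - 1)\<close>,
  acyclicity is automatic.
\<close>

definition realization :: "'a set \<Rightarrow> ('a \<Rightarrow> nat) \<Rightarrow> 'a rel \<Rightarrow> bool" where
  "realization V d T \<longleftrightarrow> T \<subseteq> V \<times> V \<and> sym T \<and> irrefl T \<and>
     (\<forall>a\<in>V. \<forall>b\<in>V. (a, b) \<in> T\<^sup>*) \<and> (\<forall>a\<in>V. card (T `` {a}) = d a)"

lemma card_eq_sum_Image:
  assumes "finite V" "T \<subseteq> V \<times> V"
  shows "card T = (\<Sum>a\<in>V. card (T `` {a}))"
proof -
  have "T = (SIGMA a:V. T `` {a})" using assms by auto
  moreover have "\<forall>a\<in>V. finite (T `` {a})"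
    using assms by (meson finite_Image finite_SigmaI finite_subset)
  ultimately show ?thesis using card_SigmaI[OF assms(1), of "\<lambda>a. T `` {a}"] by simp
qed

text \<open>Take \<open>h\<close> to be the distance to \<open>R\<close>, \<open>p z\<close> the
  next vertex on a shortest path to \<open>R\<close>, and \<open>r z\<close> the vertex of
  \<open>R\<close> reached by iterating \<open>p\<close>. Rooting at the two ends of an edge
  describes its two sides; rooting at one vertex serves to exclude cycles.\<close>

lemma parent_function_exists:
  assumes "T \<subseteq> V \<times> V" "\<forall>a\<in>V. \<forall>b\<in>V. (a, b) \<in> T\<^sup>*" "R \<subseteq> V" "R \<noteq> {}"
  obtains p and h :: "'a \<Rightarrow> nat" and r
  where "\<And>z. z \<in> V - R \<Longrightarrow> p z \<in> V \<and> (z, p z) \<in> T \<and> h (p z) < h z \<and> r (p z) = r z"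
    and "\<And>z. z \<in> R \<Longrightarrow> r z = z" and "\<And>z. z \<in> V \<Longrightarrow> r z \<in> R"
proof -
  define h where "h z = (LEAST k. \<exists>a\<in>R. (z, a) \<in> T ^^ k)" for z
  have ex: "\<exists>k. \<exists>a\<in>R. (z, a) \<in> T ^^ k" if "z \<in> V" for z
    using assms that by (meson ex_in_conv rtrancl_power subsetD)
  have h: "\<exists>a\<in>R. (z, a) \<in> T ^^ h z" if "z \<in> V" for z
    unfolding h_def by (rule LeastI_ex[OF ex[OF that]])
  have h_le: "h z \<le> k" if "(z, a) \<in> T ^^ k" "a \<in> R" for z a k
    unfolding h_def by (rule Least_le) (use that in blast)
  have step: "\<exists>y. y \<in> V \<and> (z, y) \<in> T \<and> h z = Suc (h y)" if z: "z \<in> V - R" for z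
  proof -
    obtain a where a: "a \<in> R" "(z, a) \<in> T ^^ h z" using h z by blast
    have "h z \<noteq> 0" using a z by (cases "h z") auto
    then obtain k where k: "h z = Suc k" by (cases "h z") auto
    then obtain y where y: "(z, y) \<in> T" "(y, a) \<in> T ^^ k"
      using a(2) relpow_Suc_D2 by metis
    have "y \<in> V" using y(1) assms(1) by auto
    then obtain b where b: "b \<in> R" "(y, b) \<in> T ^^ h y" using h by blast
    have "(z, b) \<in> T ^^ Suc (h y)" using y(1) b(2) by (rule relpow_Suc_I2)
    then have "h z \<le> Suc (h y)" using h_le b(1) by blast
    moreover have "h y \<le> k" using h_le y(2) a(1) by blast
    ultimately show ?thesis using y(1) \<open>y \<in> V\<close> k by auto
  qed
  define p where "p z = (SOME y. y \<in> V \<and> (z, y) \<in> T \<and> h z = Suc (h y))" for z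
  have p: "p z \<in> V \<and> (z, p z) \<in> T \<and> h z = Suc (h (p z))" if "z \<in> V - R" for z
    unfolding p_def by (rule someI_ex[OF step[OF that]])
  \<comment> \<open>\<open>p\<close> lowers \<open>h\<close> by exactly one, so \<open>h z\<close>
    steps end in \<open>R\<close>, and starting from \<open>p z\<close> just drops the first of
    them.\<close>
  define r where "r z = (p ^^ h z) z" for z
  have rp: "r (p z) = r z" if "z \<in> V - R" for z
    using p[OF that] by (simp add: r_def funpow_swap1)
  have h0: "h z = 0" if "z \<in> R" for z
    using h_le[of z z 0] that by simp
  have rR: "r z = z" if "z \<in> R" for z
    using h0[OF that] by (simp add: r_def)
  have "r z \<in> R" if "z \<in> V" for z
    using that
  proof (induction "h z" arbitrary: z rule: less_induct)
    case less
    show ?case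
    proof (cases "z \<in> R")
      case False
      then have z: "z \<in> V - R" using less.prems by simp
      have "r (p z) \<in> R" using p[OF z] by (intro less.hyps) auto
      then show ?thesis using rp[OF z] by simp
    qed (simp add: rR)
  qed
  then show thesis using that[of p h r] p rp rR by auto
qed

text \<open>
  By counting, the arcs between a vertex and its parent leave no room for others outside \<open>R\<close>.
\<close>

lemma arc_cases_parent:
  assumes V: "finite V" and T: "T \<subseteq> V \<times> V" "sym T"
    and p: "\<And>z. z \<in> V - R \<Longrightarrow> (z, p z) \<in> T \<and> (h (p z) :: nat) < h z"
    and card: "card T \<le> 2 * card (V - R) + card (T \<inter> R \<times> R)"
    and ab: "(a, b) \<in> T"
  shows "a \<in> R \<and> b \<in> R \<or> a \<notin> R \<and> b = p a \<or> b \<notin> R \<and> a = p b"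
proof -
  \<comment> \<open>Arcs to the parent, their reverses, and arcs inside \<open>R\<close> are
    disjoint and already attain the bound on \<open>card T\<close>, so they are all of
    \<open>T\<close>.\<close>
  define A where "A = (\<lambda>z. (z, p z)) ` (V - R)"
  define B where "B = (\<lambda>z. (p z, z)) ` (V - R)"
  define C where "C = T \<inter> R \<times> R"
  have fT: "finite T" using V T by (meson finite_SigmaI finite_subset)
  have fin: "finite A" "finite B" "finite C" using V fT by (auto simp: A_def B_def C_def)
  have cA: "card A = card (V - R)" unfolding A_def by (rule card_image) (auto simp: inj_on_def)
  have cB: "card B = card (V - R)" unfolding B_def by (rule card_image) (auto simp: inj_on_def)
  have AB: "A \<inter> B = {}"
  proof (rule ccontr)
    assume "A \<inter> B \<noteq> {}"
    then obtain z z' where "z \<in> V - R" "z' \<in> V - R" "z = p z'" "p z = z'"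
      by (auto simp: A_def B_def)
    then show False using p[of z] p[of z'] by auto
  qed
  have ABC: "(A \<union> B) \<inter> C = {}" by (auto simp: A_def B_def C_def)
  have sub: "A \<union> B \<union> C \<subseteq> T" using p T(2) by (auto simp: A_def B_def C_def dest: symD)
  have "card (A \<union> B \<union> C) = 2 * card (V - R) + card C"
    using AB ABC fin cA cB by (simp add: card_Un_disjoint)
  then have "A \<union> B \<union> C = T" using sub fT card by (intro card_seteq) (auto simp: C_def)
  then have "(a, b) \<in> A \<union> B \<union> C" using ab by simp
  then show ?thesis by (auto simp: A_def B_def C_def)
qed

section \<open>Existence of a tree with prescribed degrees\<close>

text \<open>Induction on the number of vertices. From three vertices on, the degree sum forces a
  vertex \<open>l\<close> of degree 1 and a vertex \<open>w\<close> of degree at least 2. Delete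
  \<open>l\<close>, lower the degree of \<open>w\<close> by one, and hang \<open>l\<close> on
  \<open>w\<close> in the smaller tree.\<close>

lemma realization_exists:
  fixes d :: "'a \<Rightarrow> nat"
  assumes "finite V" "2 \<le> card V" "\<forall>a\<in>V. 1 \<le> d a" "sum d V + 2 = 2 * card V"
  shows "\<exists>T. realization V d T"
  using assms
proof (induction "card V" arbitrary: V d rule: less_induct)
  case less
  note fin = \<open>finite V\<close> and pos = \<open>\<forall>a\<in>V. 1 \<le> d a\<close> and sum = \<open>sum d V + 2 = 2 * card V\<close>
  show ?case
  proof (cases "card V = 2")
    case True
    then obtain a b where ab: "V = {a, b}" "a \<noteq> b" by (meson card_2_iff)
    have "d a + d b = 2" using sum True ab by simp
    then have d: "d a = 1" "d b = 1" using pos ab by (auto simp: le_Suc_eq)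
    have "{(a, b), (b, a)} `` {a} = {b}" "{(a, b), (b, a)} `` {b} = {a}" using ab by auto
    then have "realization V d {(a, b), (b, a)}"
      using ab d by (auto simp: realization_def sym_def irrefl_def)
    then show ?thesis by blast
  next
    case False
    then have c3: "3 \<le> card V" using less.prems by simp
    have "\<exists>l\<in>V. d l = 1"
    proof (rule ccontr)
      assume "\<not> ?thesis"
      then have "2 \<le> d a" if "a \<in> V" for a using pos that
        by (metis Suc_1 Suc_leI le_neq_implies_less One_nat_def)
      then have "(\<Sum>a\<in>V. 2) \<le> sum d V" by (rule sum_mono)
      then show False using sum by simp
    qed
    then obtain l where l: "l \<in> V" "d l = 1" by blast
    have "\<exists>w\<in>V. 2 \<le> d w"
    proof (rule ccontr)
      assume "\<not> ?thesis"
      then have "d a \<le> 1" if "a \<in> V" for a using that by force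
      then have "sum d V \<le> (\<Sum>a\<in>V. 1)" by (rule sum_mono)
      then show False using sum c3 by simp
    qed
    then obtain w where w: "w \<in> V" "2 \<le> d w" by blast
    have wl: "w \<noteq> l" using l w by auto
    define d' where "d' = d(w := d w - 1)"
    have "sum d V = d l + (d w + sum d (V - {l} - {w}))"
      using fin l w wl by (simp add: sum.remove)
    moreover have "sum d' (V - {l}) = d' w + sum d' (V - {l} - {w})"
      using fin w wl by (simp add: sum.remove)
    moreover have "sum d' (V - {l} - {w}) = sum d (V - {l} - {w})"
      by (rule sum.cong) (auto simp: d'_def)
    ultimately have "sum d' (V - {l}) + 2 = sum d V" using l w by (simp add: d'_def)
    moreover have cV: "card (V - {l}) = card V - 1" using fin l by simp
    ultimately have "sum d' (V - {l}) + 2 = 2 * card (V - {l})" using sum c3 by simp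
    moreover have "\<forall>a\<in>V - {l}. 1 \<le> d' a" using pos w by (auto simp: d'_def)
    ultimately obtain T where T: "realization (V - {l}) d' T"
      using less.hyps[of "V - {l}" d'] cV c3 fin by fastforce
    define T' where "T' = insert (w, l) (insert (l, w) T)"
    have TV: "T \<subseteq> (V - {l}) \<times> (V - {l})" using T by (simp add: realization_def)
    have mono: "T\<^sup>* \<subseteq> T'\<^sup>*" by (rule rtrancl_mono) (auto simp: T'_def)
    have toW: "(a, w) \<in> T'\<^sup>* \<and> (w, a) \<in> T'\<^sup>*" if "a \<in> V" for a
    proof (cases "a = l")
      case False
      then have "(a, w) \<in> T\<^sup>*" "(w, a) \<in> T\<^sup>*" using T that w wl by (auto simp: realization_def)
      then show ?thesis using mono by auto
    qed (auto simp: T'_def)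
    have conn: "\<forall>a\<in>V. \<forall>b\<in>V. (a, b) \<in> T'\<^sup>*" using toW by (meson rtrancl_trans)
    have fT: "finite T" using TV fin by (meson finite_Diff finite_SigmaI finite_subset)
    have "card (T' `` {a}) = d a" if a: "a \<in> V" for a
    proof -
      consider "a = l" | "a = w" | "a \<noteq> l" "a \<noteq> w" by blast
      then show ?thesis
      proof cases
        case 1
        then have "T' `` {a} = {w}" using TV wl by (auto simp: T'_def)
        then show ?thesis using 1 l by simp
      next
        case 2
        then have "T' `` {a} = insert l (T `` {w})" using wl by (auto simp: T'_def)
        moreover have "l \<notin> T `` {w}" using TV by auto
        moreover have "card (T `` {w}) = d w - 1"
          using T w wl by (auto simp: realization_def d'_def)
        ultimately show ?thesis using 2 w fT by (simp add: finite_Image)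
      next
        case 3
        then have "T' `` {a} = T `` {a}" by (auto simp: T'_def)
        then show ?thesis using T 3 a by (auto simp: realization_def d'_def)
      qed
    qed
    moreover have "T' \<subseteq> V \<times> V" "sym T'" "irrefl T'"
      using T l w wl by (auto simp: realization_def T'_def sym_def irrefl_def)
    ultimately have "realization V d T'" using conn by (simp add: realization_def)
    then show ?thesis by blast
  qed
qed

section \<open>Exchanging two tree edges\<close>

definition exchange :: "'a rel \<Rightarrow> 'a \<Rightarrow> 'a \<Rightarrow> 'a \<Rightarrow> 'a \<Rightarrow> 'a rel" where
  "exchange T a b x y =
     T - {(a, b), (b, a), (x, y), (y, x)} \<union> {(b, x), (x, b), (a, y), (y, a)}"

text \<open>By \<open>path\<close>, \<open>x\<close> and \<open>a\<close> stay connected after the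
  deletions, so the new edges give a chain from \<open>b\<close> to \<open>x\<close>, on to
  \<open>a\<close>, then to \<open>y\<close>; it bypasses both deleted edges. Each of the four ends
  loses one neighbour and gains another, so degrees persist.\<close>

lemma realization_exchange:
  assumes T: "realization V d T" and fin: "finite V"
    and arcs: "(a, b) \<in> T" "(x, y) \<in> T"
    and ne: "a \<noteq> x" "a \<noteq> y" "b \<noteq> x" "b \<noteq> y"
    and new: "(b, x) \<notin> T" "(a, y) \<notin> T"
    and path: "(x, a) \<in> (T - {(a, b), (b, a), (x, y), (y, x)})\<^sup>*"
  shows "realization V d (exchange T a b x y)"
proof -
  let ?F = "T - {(a, b), (b, a), (x, y), (y, x)}" and ?T = "exchange T a b x y"
  have TV: "T \<subseteq> V \<times> V" and sT: "sym T" and iT: "irrefl T"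
    and conn: "\<forall>a\<in>V. \<forall>b\<in>V. (a, b) \<in> T\<^sup>*" and deg: "\<forall>a\<in>V. card (T `` {a}) = d a"
    using T by (simp_all add: realization_def)
  have mem: "a \<in> V" "b \<in> V" "x \<in> V" "y \<in> V" using arcs TV by auto
  have ne': "a \<noteq> b" "x \<noteq> y" using arcs iT by (auto simp: irrefl_def)
  have sF: "sym ?F" using sT by (auto simp: sym_def)
  have "(a, x) \<in> ?F\<^sup>*" using path sF by (meson symD sym_rtrancl)
  moreover have "?F\<^sup>* \<subseteq> ?T\<^sup>*" by (rule rtrancl_mono) (auto simp: exchange_def)
  ultimately have xa: "(x, a) \<in> ?T\<^sup>*" "(a, x) \<in> ?T\<^sup>*" using path by auto
  have new_arcs: "(b, x) \<in> ?T" "(x, b) \<in> ?T" "(a, y) \<in> ?T" "(y, a) \<in> ?T"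
    by (auto simp: exchange_def)
  have "(a, b) \<in> ?T\<^sup>*" "(b, a) \<in> ?T\<^sup>*" "(x, y) \<in> ?T\<^sup>*" "(y, x) \<in> ?T\<^sup>*"
    using xa new_arcs by (meson rtrancl.rtrancl_into_rtrancl converse_rtrancl_into_rtrancl)+
  then have "T \<subseteq> ?T\<^sup>*" by (auto simp: exchange_def)
  then have "T\<^sup>* \<subseteq> ?T\<^sup>*" using rtrancl_subset_rtrancl by blast
  then have conn': "\<forall>a\<in>V. \<forall>b\<in>V. (a, b) \<in> ?T\<^sup>*" using conn by blast
  have fT: "finite T" using TV fin by (meson finite_SigmaI finite_subset)
  have swap: "card (insert s (N - {t})) = card N" if "finite N" "t \<in> N" "s \<notin> N"
    for N :: "'a set" and s t
    using that by (metis Diff_iff card_Suc_Diff1 card_insert_disjoint finite_Diff)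
  have "card (?T `` {c}) = d c" if c: "c \<in> V" for c
  proof -
    have sym': "(b, a) \<in> T" "(y, x) \<in> T" "(x, b) \<notin> T" "(y, a) \<notin> T"
      using arcs new sT by (auto dest: symD)
    have fN: "finite (T `` {c})" using fT by (simp add: finite_Image)
    have "card (?T `` {c}) = card (T `` {c})"
    proof -
      consider "c = a" | "c = b" | "c = x" | "c = y" | "c \<notin> {a, b, x, y}" by blast
      then show ?thesis
      proof cases
        case 1
        then have "?T `` {c} = insert y (T `` {c} - {b})" using ne ne' by (auto simp: exchange_def)
        then show ?thesis using swap[OF fN, of b y] 1 arcs new by simp
      next
        case 2
        then have "?T `` {c} = insert x (T `` {c} - {a})" using ne ne' by (auto simp: exchange_def)
        then show ?thesis using swap[OF fN, of a x] 2 sym' new by simp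
      next
        case 3
        then have "?T `` {c} = insert b (T `` {c} - {y})" using ne ne' by (auto simp: exchange_def)
        then show ?thesis using swap[OF fN, of y b] 3 arcs sym' by simp
      next
        case 4
        then have "?T `` {c} = insert a (T `` {c} - {x})" using ne ne' by (auto simp: exchange_def)
        then show ?thesis using swap[OF fN, of x a] 4 sym' by simp
      next
        case 5
        then have "?T `` {c} = T `` {c}" by (auto simp: exchange_def)
        then show ?thesis by simp
      qed
    qed
    then show ?thesis using deg c by simp
  qed
  moreover have "?T \<subseteq> V \<times> V" using TV mem by (auto simp: exchange_def)
  moreover have "sym ?T" using sT by (auto simp: exchange_def sym_def)
  moreover have "irrefl ?T" using iT ne by (auto simp: exchange_def irrefl_def)
  ultimately show ?thesis using conn' by (simp add: realization_def)
qed

lemma realization_improve: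
  assumes T: "realization V d T" and fin: "finite V"
    and sum: "sum d V + 2 = 2 * card V" and d3: "\<forall>a\<in>V. d a \<le> 3"
    and H: "H \<subseteq> V \<times> V" "sym H"
    and uv: "(u, v) \<in> T" "(u, v) \<in> H"
    and small: "2 * (card (H `` {u}) + card (H `` {v})) + 3 \<le> card V"
  shows "\<exists>T'. realization V d T' \<and> T' \<inter> H \<subset> T \<inter> H"
proof -
  have TV: "T \<subseteq> V \<times> V" and sT: "sym T" and iT: "irrefl T"
    and conn: "\<forall>a\<in>V. \<forall>b\<in>V. (a, b) \<in> T\<^sup>*" and deg: "\<forall>a\<in>V. card (T `` {a}) = d a"
    using T by (simp_all add: realization_def)
  have fT: "finite T" and fH: "finite H"
    using TV H fin by (meson finite_SigmaI finite_subset)+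
  define R where "R = {u, v}"
  have mem: "u \<in> V" "v \<in> V" using uv TV by auto
  have une: "u \<noteq> v" using uv iT by (auto simp: irrefl_def)
  have vu: "(v, u) \<in> T" "(v, u) \<in> H" using uv sT H by (auto dest: symD)
  have RV: "R \<subseteq> V" "R \<noteq> {}" using mem by (auto simp: R_def)
  \<comment> \<open>With root set \<open>{u, v}\<close>, \<open>r z\<close> is the end of
    \<open>uv\<close> on whose side \<open>z\<close> lies.\<close>
  obtain p r and h :: "'a \<Rightarrow> nat" where
      p: "\<And>z. z \<in> V - R \<Longrightarrow> p z \<in> V \<and> (z, p z) \<in> T \<and> h (p z) < h z \<and> r (p z) = r z"
    and rR: "\<And>z. z \<in> R \<Longrightarrow> r z = z" and r_in: "\<And>z. z \<in> V \<Longrightarrow> r z \<in> R"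
    by (rule parent_function_exists[OF TV conn RV]) blast
  have cardVR: "card (V - R) + 2 = card V"
  proof -
    have "card R = 2" using une by (simp add: R_def)
    moreover have "card R \<le> card V" using RV fin by (simp add: card_mono)
    ultimately show ?thesis using card_Diff_subset[of R V] RV fin finite_subset[of R V] by simp
  qed
  have TR: "T \<inter> R \<times> R = {(u, v), (v, u)}" using uv vu iT by (auto simp: R_def irrefl_def)
  have "card T = sum d V" using card_eq_sum_Image[OF fin TV] deg by simp
  then have "card T \<le> 2 * card (V - R) + card (T \<inter> R \<times> R)"
    using sum cardVR une unfolding TR by simp
  \<comment> \<open>Every tree arc other than the two orientations of \<open>uv\<close> joins a
    vertex to its parent.\<close>
  then have arc_cases: "a \<in> R \<and> b \<in> R \<or> a \<notin> R \<and> b = p a \<or> b \<notin> R \<and> a = p b" if "(a, b) \<in> T" for a b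
    using arc_cases_parent[OF fin TV sT, of R p h a b] p that by blast

  \<comment> \<open>The edge \<open>xy\<close> is coded by its far end \<open>y\<close>, with
    \<open>x = p y\<close>. Of the \<open>n - 2\<close> vertices outside \<open>R\<close>, only
    neighbours of \<open>u\<close> or \<open>v\<close> drop out, at most two for each.\<close>
  define cand where "cand = {z \<in> V - R. p z \<notin> R}"
  have cand: "card V \<le> card cand + 6"
  proof -
    have "V - R \<subseteq> cand \<union> (T `` {u} - {v}) \<union> (T `` {v} - {u})"
      using p sT by (auto simp: cand_def R_def dest: symD)
    then have "card (V - R) \<le> card (cand \<union> (T `` {u} - {v}) \<union> (T `` {v} - {u}))"
      using fin fT by (intro card_mono) (auto simp: cand_def finite_Image)
    also have "\<dots> \<le> card cand + card (T `` {u} - {v}) + card (T `` {v} - {u})"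
      by (meson add_le_mono card_Un_le le_refl le_trans)
    also have "card (T `` {u} - {v}) \<le> 2"
      using d3 deg mem uv fT by (force simp: card_Diff_singleton)
    also have "card (T `` {v} - {u}) \<le> 2"
      using d3 deg mem vu fT by (force simp: card_Diff_singleton)
    finally show ?thesis using cardVR by simp
  qed

  text \<open>\<open>B s w\<close> collects the candidates spoilt by the non-edge from \<open>s\<close> to \<open>w\<close>: those whose
    exchange would insert it.  Since \<open>r (p z) = r z\<close>, only one of the two alternatives can occur
    for a given \<open>w\<close>.\<close>
  define B where "B s w = {z \<in> cand. (r z \<noteq> s \<and> p z = w) \<or> (r z = s \<and> z = w)}" for s w
  \<comment> \<open>If \<open>r w = s\<close>, only \<open>w\<close> itself can be spoilt. Otherwise
    only children of \<open>w\<close> can be, and there are at most two, one of its at most three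
    neighbours being its parent.\<close>
  have B2: "card (B s w) \<le> 2" for s w
  proof (cases "r w = s \<or> w \<notin> V - R")
    case True
    then have "B s w \<subseteq> {w}" using p by (auto simp: B_def cand_def)
    then have "card (B s w) \<le> card {w}" by (intro card_mono) auto
    then show ?thesis by simp
  next
    case False
    then have w: "w \<in> V - R" "r w \<noteq> s" by auto
    have "B s w \<subseteq> T `` {w} - {p w}"
    proof
      fix z assume z: "z \<in> B s w"
      then have zV: "z \<in> V - R" by (auto simp: B_def cand_def)
      have zw: "p z = w" using z w by (auto simp: B_def)
      have "(w, z) \<in> T" using p[OF zV] zw sT by (auto dest: symD)
      moreover have "z \<noteq> p w" using p[OF zV] p[OF w(1)] zw by auto
      ultimately show "z \<in> T `` {w} - {p w}" by simp
    qed
    then have "card (B s w) \<le> card (T `` {w} - {p w})"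
      using fT by (intro card_mono) (auto simp: finite_Image)
    also have "\<dots> = card (T `` {w}) - 1" using p[OF w(1)] fT by (simp add: card_Diff_singleton)
    also have "\<dots> \<le> 2" using deg d3 w by force
    finally show ?thesis .
  qed
  \<comment> \<open>The non-edge \<open>uv\<close> spoils nothing, since candidates and their
    parents avoid \<open>R\<close>. Leaving it out of both unions saves the 4 that brings
    \<open>bad\<close> down to \<open>n - 7\<close> against at least \<open>n - 6\<close>
    candidates.\<close>
  define bad where "bad = (\<Union>w\<in>H `` {u} - {v}. B u w) \<union> (\<Union>w\<in>H `` {v} - {u}. B v w)"
  have UB: "card (\<Union>w\<in>W. B s w) \<le> 2 * card W" if "finite W" for s W
  proof -
    have "card (\<Union>w\<in>W. B s w) \<le> (\<Sum>w\<in>W. card (B s w))" using that by (rule card_UN_le)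
    also have "\<dots> \<le> (\<Sum>w\<in>W. 2)" by (rule sum_mono) (rule B2)
    finally show ?thesis by simp
  qed
  have "card bad \<le> 2 * card (H `` {u} - {v}) + 2 * card (H `` {v} - {u})"
    unfolding bad_def using fH
    by (intro order_trans[OF card_Un_le] add_mono UB) (auto simp: finite_Image)
  also have "card (H `` {u} - {v}) = card (H `` {u}) - 1"
    using uv fH by (simp add: card_Diff_singleton)
  also have "card (H `` {v} - {u}) = card (H `` {v}) - 1"
    using vu fH by (simp add: card_Diff_singleton)
  finally have "card bad \<le> 2 * (card (H `` {u}) - 1) + 2 * (card (H `` {v}) - 1)" .
  moreover have "card (H `` {u}) \<noteq> 0" "card (H `` {v}) \<noteq> 0"
    using uv vu fH by (auto simp: finite_Image)
  ultimately have "card bad + 4 \<le> 2 * (card (H `` {u}) + card (H `` {v}))" by simp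
  then have "card bad < card cand" using small cand by linarith
  moreover have "finite bad" using fin fH by (auto simp: bad_def B_def cand_def finite_Image)
  ultimately have "\<not> cand \<subseteq> bad" by (meson card_mono leD)
  then obtain y where y: "y \<in> cand" "y \<notin> bad" by blast
  define x where "x = p y"
  \<comment> \<open>\<open>a\<close> is the end of \<open>uv\<close> on the side of \<open>y\<close>
    and \<open>b\<close> the other end, which treats both sides at once.\<close>
  define a where "a = r y"
  define b where "b = (if a = u then v else u)"
  have yV: "y \<in> V - R" and xV: "x \<in> V - R" using y p by (auto simp: cand_def x_def)
  have aR: "a \<in> R" using r_in yV by (auto simp: a_def)
  have ab: "R = {a, b}" "a \<noteq> b" using aR une by (auto simp: b_def R_def)
  have abT: "(a, b) \<in> T" "(a, b) \<in> H" using uv vu aR by (auto simp: b_def R_def)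
  have xyT: "(x, y) \<in> T" using p[OF yV] sT by (auto simp: x_def dest: symD)
  have rx: "r x = a" using p[OF yV] by (simp add: x_def a_def)
  have hxy: "h x < h y" using p[OF yV] by (simp add: x_def)
  have ne: "a \<noteq> x" "a \<noteq> y" "b \<noteq> x" "b \<noteq> y" using xV yV ab by auto
  have bx: "(b, x) \<notin> T"
  proof
    assume "(b, x) \<in> T"
    then have "b = p x" using arc_cases ab xV by blast
    then show False using p[OF xV] rR[of b] rx ab by auto
  qed
  have ay: "(a, y) \<notin> T"
  proof
    assume "(a, y) \<in> T"
    then have "a = p y" using arc_cases ab yV by blast
    then show False using ne x_def by simp
  qed
  \<comment> \<open>\<open>bx\<close> matches the first alternative in \<open>B b x\<close>, as
    \<open>r y = a\<close> differs from \<open>b\<close>; \<open>ay\<close> matches the second in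
    \<open>B a y\<close>.\<close>
  have notH: "(b, x) \<notin> H" "(a, y) \<notin> H"
  proof -
    show "(b, x) \<notin> H"
    proof
      assume "(b, x) \<in> H"
      moreover have "y \<in> B b x" using y ab by (auto simp: B_def x_def a_def[symmetric])
      ultimately have "y \<in> bad" using ab ne unfolding bad_def R_def by (auto simp: doubleton_eq_iff)
      then show False using y by simp
    qed
    show "(a, y) \<notin> H"
    proof
      assume "(a, y) \<in> H"
      moreover have "y \<in> B a y" using y by (auto simp: B_def a_def)
      ultimately have "y \<in> bad" using ab ne unfolding bad_def R_def by (auto simp: doubleton_eq_iff)
      then show False using y by simp
    qed
  qed
  \<comment> \<open>Climbing by \<open>p\<close> from a height below \<open>h y\<close> never visits
    \<open>y\<close>, so avoids \<open>xy\<close>; each step starts outside \<open>R\<close>, so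
    avoids \<open>ab\<close>.\<close>
  have path: "(c, r c) \<in> (T - {(a, b), (b, a), (x, y), (y, x)})\<^sup>*" if "c \<in> V" "h c < h y" for c
    using that
  proof (induction "h c" arbitrary: c rule: less_induct)
    case less
    show ?case
    proof (cases "c \<in> R")
      case False
      then have c: "c \<in> V - R" using less.prems by simp
      have "(p c, r (p c)) \<in> (T - {(a, b), (b, a), (x, y), (y, x)})\<^sup>*"
        using p[OF c] less.prems by (intro less.hyps) auto
      moreover have "(c, p c) \<in> T - {(a, b), (b, a), (x, y), (y, x)}"
        using p[OF c] less.prems c ab by auto
      ultimately show ?thesis using p[OF c] by (metis converse_rtrancl_into_rtrancl)
    qed (simp add: rR)
  qed
  have "(x, a) \<in> (T - {(a, b), (b, a), (x, y), (y, x)})\<^sup>*"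
    using path[of x] xV hxy rx by simp
  then have "realization V d (exchange T a b x y)"
    by (intro realization_exchange T fin abT xyT ne bx ay)
  moreover have "exchange T a b x y \<inter> H \<subset> T \<inter> H"
  proof
    show "exchange T a b x y \<inter> H \<subseteq> T \<inter> H"
      using notH H(2) by (auto simp: exchange_def dest: symD)
    have "(a, b) \<notin> exchange T a b x y" using ne ab by (auto simp: exchange_def)
    then show "exchange T a b x y \<inter> H \<noteq> T \<inter> H" using abT by blast
  qed
  ultimately show ?thesis by blast
qed

section \<open>Absence of long cycles\<close>

lemma snd_nth_pcas:
  assumes "pcas u q v" "i < length q"
  shows "snd (q ! i) = (if Suc i < length q then fst (q ! Suc i) else v)"
  using assms
proof (induction q arbitrary: u i)
  case (Cons e q)
  show ?case
  proof (cases i)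
    case 0
    then show ?thesis using Cons.prems by (cases q) auto
  next
    case (Suc j)
    then show ?thesis using Cons by auto
  qed
qed simp

lemma pawalk_verts_pcas: "pcas u q v \<Longrightarrow> pawalk_verts u q = u # map snd q"
  by (induction q arbitrary: u) auto

text \<open>Root the tree at a vertex. At a highest vertex of the cycle both cycle neighbours must
  be its parent, hence equal; as the cycle does not repeat vertices, its length is at most
  2.\<close>

lemma realization_no_long_cycle:
  assumes T: "realization V d T" and fin: "finite V"
    and sum: "sum d V + 2 = 2 * card V"
    and q: "set q \<subseteq> T" "pcas c q c" "distinct (tl (pawalk_verts c q))"
  shows "length q < 3"
proof (rule ccontr)
  assume "\<not> length q < 3"
  then have len: "3 \<le> length q" by simp
  define k where "k = length q"
  have TV: "T \<subseteq> V \<times> V" and sT: "sym T" and iT: "irrefl T"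
    and conn: "\<forall>a\<in>V. \<forall>b\<in>V. (a, b) \<in> T\<^sup>*" and deg: "\<forall>a\<in>V. card (T `` {a}) = d a"
    using T by (simp_all add: realization_def)
  have "V \<noteq> {}" using sum by auto
  then obtain u where u: "u \<in> V" by blast
  then have R: "{u} \<subseteq> V" "{u} \<noteq> {}" by auto
  obtain p r and h :: "'a \<Rightarrow> nat" where
      p: "\<And>z. z \<in> V - {u} \<Longrightarrow> p z \<in> V \<and> (z, p z) \<in> T \<and> h (p z) < h z \<and> r (p z) = r z"
    and "\<And>z. z \<in> {u} \<Longrightarrow> r z = z" and "\<And>z. z \<in> V \<Longrightarrow> r z \<in> {u}"
    by (rule parent_function_exists[OF TV conn R]) blast
  have "card T = sum d V" using card_eq_sum_Image[OF fin TV] deg by simp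
  then have "card T \<le> 2 * card (V - {u}) + card (T \<inter> {u} \<times> {u})"
    using sum u fin by (simp add: card_Diff_singleton)
  then have arc_cases: "a \<noteq> u \<and> b = p a \<or> b \<noteq> u \<and> a = p b" if "(a, b) \<in> T" for a b
    using arc_cases_parent[OF fin TV sT, of "{u}" p h a b] p that iT
    by (auto simp: irrefl_def)
  have up: "a = p b" if "(a, b) \<in> T" "h a \<le> h b" for a b
    using arc_cases[OF that(1)] p[of a] that TV by auto
  \<comment> \<open>The cycle's vertices, indexed periodically to avoid wrap-around cases.\<close>
  define z where "z i = snd (q ! (i mod k))" for i
  have kpos: "0 < k" using len unfolding k_def by linarith
  have z_arc: "(z i, z (Suc i)) \<in> T" for i
  proof -
    let ?j = "i mod k"
    have j: "?j < k" using kpos by simp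
    have "z i = fst (q ! (Suc i mod k))"
    proof (cases "Suc ?j < k")
      case True
      then have "Suc i mod k = Suc ?j" by (simp add: mod_Suc)
      then show ?thesis using snd_nth_pcas[OF q(2), of ?j] j True by (simp add: z_def k_def)
    next
      case False
      then have "Suc i mod k = 0" using j by (simp add: mod_Suc)
      moreover have "fst (q ! 0) = c" using q(2) len by (cases q) auto
      ultimately show ?thesis
        using snd_nth_pcas[OF q(2), of ?j] j False by (simp add: z_def k_def)
    qed
    then have "(z i, z (Suc i)) = q ! (Suc i mod k)" by (simp add: z_def)
    then show ?thesis using q(1) kpos by (metis k_def mod_less_divisor nth_mem subsetD)
  qed
  have dist: "distinct (map snd q)" using q(2,3) pawalk_verts_pcas by fastforce
  have z_inj: "i mod k = j mod k" if "z i = z j" for i j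
    using that nth_eq_iff_index_eq[OF dist, of "i mod k" "j mod k"] kpos
    by (simp add: z_def k_def del: length_greater_0_conv)
  have "finite (range (h \<circ> z))"
  proof -
    have "range (h \<circ> z) \<subseteq> (h \<circ> snd) ` set q" using kpos by (auto simp: z_def k_def)
    then show ?thesis by (meson List.finite_set finite_imageI finite_subset)
  qed
  then have top: "Max (range (h \<circ> z)) \<in> range (h \<circ> z)" "\<And>i. (h \<circ> z) i \<le> Max (range (h \<circ> z))"
    by (auto intro: Max_in Max_ge)
  then obtain m where "Max (range (h \<circ> z)) = (h \<circ> z) m" by blast
  then have m: "h (z i) \<le> h (z m)" for i using top(2)[of i] by simp
  \<comment> \<open>The index before \<open>m\<close> modulo \<open>k\<close>, written without
    subtracting from \<open>m\<close>, which may be 0.\<close>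
  define l where "l = m + (k - 1)"
  have "z (Suc l) = z m" using kpos by (simp add: z_def l_def)
  then have "(z l, z m) \<in> T" using z_arc[of l] by simp
  then have "z l = p (z m)" using up m by blast
  moreover have "(z (Suc m), z m) \<in> T" using z_arc[of m] sT by (auto dest: symD)
  then have "z (Suc m) = p (z m)" using up m by blast
  ultimately have "l mod k = Suc m mod k" using z_inj by simp
  \<comment> \<open>The two neighbours' indices differ by \<open>k - 2\<close>, which lies strictly
    between 0 and \<open>k\<close>.\<close>
  then have "(k - 2) mod k = 0"
    using len mod_eq_dvd_iff_nat[of "Suc m" l k] by (auto simp: l_def k_def dvd_def)
  then show False using len by (simp add: k_def)
qed

section \<open>Passing between graphs and relations\<close>

lemma vdegree_eq: "vdegree G v = card (parcs G `` {v})"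
proof -
  have "out_arcs (with_proj G) v = Pair v ` (parcs G `` {v})"
    by (auto simp: out_arcs_def)
  then show ?thesis by (simp add: vdegree_def out_degree_def card_image inj_on_def)
qed

theorem theorem2:
  fixes n :: nat and G :: "'a pair_pre_digraph" and w :: "nat \<Rightarrow> 'a"
  assumes "n \<ge> 4"
    and "pair_graph G"
    and "bij_betw w {1..n} (pverts G)"
    and "\<And>u v. u \<in> pverts G \<Longrightarrow> v \<in> pverts G \<Longrightarrow> u \<noteq> v \<Longrightarrow> (u, v) \<notin> parcs G \<Longrightarrow>
           real (vdegree G u) + real (vdegree G v) \<ge> (3 * real n - 1) / 2"
  shows "\<forall>d. arboreal n d \<and> (\<forall>i\<in>{1..n}. 1 \<le> d i \<and> d i \<le> 3) \<longrightarrow>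
           (\<exists>T. graph_spanning_tree T G \<and> has_degree_sequence T n w d)"
proof (intro allI impI)
  fix d :: "nat \<Rightarrow> nat"
  assume d: "arboreal n d \<and> (\<forall>i\<in>{1..n}. 1 \<le> d i \<and> d i \<le> 3)"
  interpret G: pair_graph G by fact
  define V where "V = pverts G"
  define E where "E = parcs G"
  \<comment> \<open>The degree sequence transported from indices to vertices.\<close>
  define e where "e = d \<circ> the_inv_into {1..n} w"
  have inj: "inj_on w {1..n}" and img: "w ` {1..n} = V"
    using assms(3) by (auto simp: bij_betw_def V_def)
  have ew: "e (w i) = d i" if "i \<in> {1..n}" for i
    using the_inv_into_f_f[OF inj that] by (simp add: e_def)
  have fin: "finite V" using img by auto
  have cV: "card V = n" using assms(3) by (auto simp: V_def dest: bij_betw_same_card)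
  have e13: "1 \<le> e a \<and> e a \<le> 3" if "a \<in> V" for a
    using d ew that unfolding img[symmetric] by auto
  have "sum e V = sum d {1..n}"
    unfolding img[symmetric] sum.reindex[OF inj] using ew by (intro sum.cong) auto
  then have "int (sum e V) = 2 * (int n - 1)" using d by (simp add: arboreal_def)
  then have "int (sum e V + 2) = int (2 * n)" by simp
  then have "sum e V + 2 = 2 * n" by (rule of_nat_eq_iff[THEN iffD1])
  then have sum: "sum e V + 2 = 2 * card V" using cV by simp
  have EV: "E \<subseteq> V \<times> V" using G.in_arcsD1 G.in_arcsD2 by (auto simp: E_def V_def)
  have sE: "sym E" using G.arcs_symmetric by (auto simp: sym_def E_def)
  have iE: "irrefl E" using G.pair_no_loops by (fastforce simp: irrefl_def E_def)
  define H where "H = {(a, b) \<in> V \<times> V. a \<noteq> b \<and> (a, b) \<notin> E}"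
  have HV: "H \<subseteq> V \<times> V" "sym H" using sE by (auto simp: H_def sym_def)
  have fH: "finite H" using HV fin by (meson finite_SigmaI finite_subset)
  have degH: "card (H `` {a}) + vdegree G a + 1 = n" if a: "a \<in> V" for a
  proof -
    have "V = insert a (H `` {a} \<union> E `` {a})" using a EV by (auto simp: H_def)
    moreover have "H `` {a} \<inter> E `` {a} = {}" "a \<notin> H `` {a} \<union> E `` {a}"
      using iE by (auto simp: H_def irrefl_def)
    moreover have "finite (H `` {a})" "finite (E `` {a})"
      using fin HV EV by (meson finite_Image finite_SigmaI finite_subset)+
    ultimately have "card V = Suc (card (H `` {a}) + card (E `` {a}))"
      by (metis card_Un_disjoint card_insert_disjoint finite_UnI)
    then show ?thesis using cV by (simp add: vdegree_eq E_def)
  qed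
  \<comment> \<open>By \<open>degH\<close>, the complement degrees of \<open>a\<close> and
    \<open>b\<close> add up to \<open>2 * n - 2\<close> minus their degrees in \<open>G\<close>;
    doubling and using the degree condition leaves at most \<open>n - 3\<close>.\<close>
  have small: "2 * (card (H `` {a}) + card (H `` {b})) + 3 \<le> card V" if ab: "(a, b) \<in> H" for a b
  proof -
    have mem: "a \<in> V" "b \<in> V" using ab HV by auto
    have "real (vdegree G a) + real (vdegree G b) \<ge> (3 * real n - 1) / 2"
      using ab by (intro assms(4)) (auto simp: H_def V_def E_def)
    then have "real (3 * n) \<le> real (2 * (vdegree G a + vdegree G b) + 1)" by simp
    then have "3 * n \<le> 2 * (vdegree G a + vdegree G b) + 1" by (simp only: of_nat_le_iff)
    then show ?thesis using degH[OF mem(1)] degH[OF mem(2)] cV by presburger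
  qed
  have "\<exists>T. realization V e T"
    using fin e13 sum cV assms(1) by (intro realization_exists) auto
  \<comment> \<open>A realization with the fewest arcs in the complement;
    \<open>realization_improve\<close> would lower a positive count.\<close>
  then obtain T where T: "realization V e T"
    and min: "\<And>T'. realization V e T' \<Longrightarrow> card (T \<inter> H) \<le> card (T' \<inter> H)"
    using ex_has_least_nat[of "realization V e" _ "\<lambda>T. card (T \<inter> H)"] by blast
  have "T \<inter> H = {}"
  proof (rule ccontr)
    assume "T \<inter> H \<noteq> {}"
    then obtain a b where ab: "(a, b) \<in> T" "(a, b) \<in> H" by auto
    then obtain T' where "realization V e T'" "T' \<inter> H \<subset> T \<inter> H"
      using realization_improve[OF T fin sum _ HV ab small[OF ab(2)]] e13 by blast
    then show False using min psubset_card_mono[of "T \<inter> H" "T' \<inter> H"] fH by (meson finite_Int leD)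
  qed
  have TV: "T \<subseteq> V \<times> V" and sT: "sym T" and iT: "irrefl T"
    and conn: "\<forall>a\<in>V. \<forall>b\<in>V. (a, b) \<in> T\<^sup>*" and deg: "\<forall>a\<in>V. card (T `` {a}) = e a"
    using T by (simp_all add: realization_def)
  have TE: "T \<subseteq> E" using \<open>T \<inter> H = {}\<close> TV iT by (auto simp: H_def irrefl_def)
  define S where "S = \<lparr>pverts = V, parcs = T\<rparr>"
  have S: "pair_graph S"
  proof unfold_locales
    show "finite (parcs S)" using TV fin by (auto simp: S_def intro: finite_subset)
    show "symmetric (with_proj S)" using sT by (simp add: symmetric_def S_def)
  qed (use TV iT fin in \<open>auto simp: S_def irrefl_def\<close>)
  then interpret S: pair_graph S .
  \<comment> \<open>Connectedness is defined through the symmetric closure, which does not change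
    reachability in the symmetric \<open>S\<close>.\<close>
  have "Digraph_Component.connected (with_proj S)"
  proof -
    have "V \<noteq> {}" using cV assms(1) by auto
    moreover have "a \<rightarrow>\<^sup>*\<^bsub>with_proj S\<^esub> b" if "a \<in> V" "b \<in> V" for a b
      using S.reachable_conv[of a b] conn that by (simp add: S_def)
    moreover have "pverts (mk_symmetric (with_proj S)) = V"
      by (simp add: mk_symmetric_def S_def)
    ultimately show ?thesis
      using S.reachable_mk_symmetric_eq[OF S.pair_sym_arcs]
      by (simp add: Digraph_Component.connected_def strongly_connected_def)
  qed
  moreover have "\<not> (\<exists>q. pre_digraph.cycle (with_proj S) q \<and> length q \<ge> 3)"
  proof
    assume "\<exists>q. pre_digraph.cycle (with_proj S) q \<and> length q \<ge> 3"
    then obtain q c where "length q \<ge> 3" "set q \<subseteq> parcs S" "pcas c q c"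
        "distinct (tl (pawalk_verts c q))"
      unfolding S.cycle_def S.awalk_def by blast
    then show False using realization_no_long_cycle[OF T fin sum, of q c] by (simp add: S_def)
  qed
  ultimately have "graph_tree S" using S by (simp add: graph_tree_def)
  moreover have "spanning (with_proj S) (with_proj G)"
    using TE G.wf_digraph S.wf_digraph
    by (auto simp: spanning_def subgraph_def S_def V_def E_def)
  moreover have "has_degree_sequence S n w d"
    using deg ew img by (auto simp: has_degree_sequence_def vdegree_eq S_def)
  ultimately show "\<exists>T. graph_spanning_tree T G \<and> has_degree_sequence T n w d"
    by (auto simp: graph_spanning_tree_def)
qed

end
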